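(* Let $G=(V,E)$ be a finite, undirected, simple, connected graph and consider the sequential SCPR game on $G$ (described in the context) with a fixed robber strategy $\sigma_3$. Define $\mathbf{v}^{(0)}$ by $v^{(0)}(\tau)=0$ and $v^{(0)}(s)=q(s)$ for all $s\in\mathbf{S}_1\cup\mathbf{S}_2$, and for $i=1,2,\dots$ define $\mathbf{v}^{(i)}$ by $v^{(i)}(\tau)=0$, \[ \forall s=(x^1,x^2,x^3,1)\in\mathbf{S}_1:\quad v^{(i)}(s)=\max_{a^1\in N[x^1]}\Big[q(s)+\sum_{s'\in\mathbf{S}}\Pr(s'\mid s,a^1,x^2)\,v^{(i-1)}(s')\Big], \] \[ \forall s=(x^1,x^2,x^3,2)\in\mathbf{S}_2:\quad v^{(i)}(s)=\min_{a^2\in N[x^2]}\Big[q(s)+\sum_{s'\in\mathbf{S}}\Pr(s'\mid s,x^1,a^2)\,v^{(i-1)}(s')\Big]. \] Then for every $s\in\mathbf{S}_1\cup\mathbf{S}_2$, $\lim_{i\to\infty}v^{(i)}(s)$ exists and equals $v(s)$, the value of the sequential SCPR game played on $G$ starting from $s$.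
   Context: $N[x]$ denotes the closed neighbourhood of a vertex $x$. The sequential Selfish Cops and Passive Robber (SCPR) game on $G$: there are two cop players $C_1,C_2$, each moving a token, and a robber token $R$ moved by chance. State space: $\mathbf{S}_1=V\times V\times V\times\{1\}$, $\mathbf{S}_2=V\times V\times V\times\{2\}$, a terminal state $\tau$, and $\mathbf{S}=\mathbf{S}_1\cup\mathbf{S}_2\cup\{\tau\}$. A state $(x^1,x^2,x^3,u)$ means the tokens $C_1,C_2,R$ are at $x^1,x^2,x^3$ and cop $C_u$ moves next. It is a $C_1$-capture state if $x^1=x^3$, and a $C_2$-capture state if $x^2=x^3$ and $x^1\neq x^3$. The robber moves according to a fixed, known, stationary Markovian (possibly randomized) strategy $\sigma_3$, with $\sigma_3(\cdot\mid s)$ a probability distribution on $N[x^3]$. Transitions: from a capture state or from $\tau$ the next state is $\tau$ with probability 1. From a non-capture state $s=(x^1,x^2,x^3,1)$, $C_1$ chooses $a^1\in N[x^1]$ ($C_2$'s only action is $a^2=x^2$) and the next state is $(a^1,x^2,x^3,2)$. From a non-capture state $s=(x^1,x^2,x^3,2)$, $C_2$ chooses $a^2\in N[x^2]$ ($C_1$'s only action is $a^1=x^1$), then the robber moves to $a^3$ drawn from $\sigma_3(\cdot\mid s)$ and the next state is $(x^1,a^2,a^3,1)$, except that if $a^2=x^3$ the robber is captured and the next state is $(x^1,x^3,x^3,1)$. $\Pr(s'\mid s,a^1,a^2)$ denotes the resulting transition probability. Strategies for $C_i$ are arbitrary history-dependent, possibly randomized, rules choosing legal actions. Immediate payoff: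 $q(s)=1$ if $s$ is a $C_1$-capture state, $q(s)=0$ otherwise ($q(\tau)=0$). For starting state $s_0$ and strategies $\sigma_1,\sigma_2$, $J(\sigma_1,\sigma_2\mid s_0)=\mathbb{E}[\sum_{t\ge0}q(s_t)]$ is $C_1$'s expected payoff ($C_2$ receives $-J$). The value $v(s_0)$ is the common value of $\sup_{\sigma_1}\inf_{\sigma_2}J(\sigma_1,\sigma_2\mid s_0)$ and $\inf_{\sigma_2}\sup_{\sigma_1}J(\sigma_1,\sigma_2\mid s_0)$ (which exists for every $s_0\in\mathbf{S}_1\cup\mathbf{S}_2$). *)

theory Defs
  imports "HOL-Probability.Probability"
begin

(* The vertex set V is the universe of the finite type 'v; E is the adjacency relation. *)

definition simple_graph :: "('v::finite \<Rightarrow> 'v \<Rightarrow> bool) \<Rightarrow> bool" where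
  "simple_graph E \<longleftrightarrow> symp E \<and> irreflp E"

definition connected_graph :: "('v::finite \<Rightarrow> 'v \<Rightarrow> bool) \<Rightarrow> bool" where
  "connected_graph E \<longleftrightarrow> (\<forall>x y. E\<^sup>*\<^sup>* x y)"

definition closed_nbhd :: "('v \<Rightarrow> 'v \<Rightarrow> bool) \<Rightarrow> 'v \<Rightarrow> 'v set" where
  "closed_nbhd E x = insert x {y. E x y}"

datatype cop = C1 | C2

datatype 'v state = Pos 'v 'v 'v cop | Tau

lemma UNIV_cop: "UNIV = {C1, C2}"
  using cop.exhaust by auto

lemma UNIV_state:
  "(UNIV :: 'v state set) =
     insert Tau ((\<lambda>(x1, x2, x3, u). Pos x1 x2 x3 u) ` (UNIV \<times> UNIV \<times> UNIV \<times> {C1, C2}))"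
proof -
  have "s \<in> insert Tau ((\<lambda>(x1, x2, x3, u). Pos x1 x2 x3 u) ` (UNIV \<times> UNIV \<times> UNIV \<times> {C1, C2}))"
    for s :: "'v state"
    by (cases s) (use UNIV_cop in \<open>auto simp: image_iff\<close>)
  then show ?thesis by blast
qed

instance state :: (finite) finite
  by standard (subst UNIV_state, simp)

definition S1 :: "'v state set" where
  "S1 = {Pos x1 x2 x3 C1 | x1 x2 x3. True}"

definition S2 :: "'v state set" where
  "S2 = {Pos x1 x2 x3 C2 | x1 x2 x3. True}"

fun capture1 :: "'v state \<Rightarrow> bool" where
  "capture1 (Pos x1 x2 x3 u) \<longleftrightarrow> x1 = x3"
| "capture1 Tau \<longleftrightarrow> False"

fun capture2 :: "'v state \<Rightarrow> bool" where
  "capture2 (Pos x1 x2 x3 u) \<longleftrightarrow> x2 = x3 \<and> x1 \<noteq> x3"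
| "capture2 Tau \<longleftrightarrow> False"

definition capture :: "'v state \<Rightarrow> bool" where
  "capture s \<longleftrightarrow> capture1 s \<or> capture2 s"

definition payoff :: "'v state \<Rightarrow> real" where
  "payoff s = (if capture1 s then 1 else 0)"

definition robber_strategy :: "('v \<Rightarrow> 'v \<Rightarrow> bool) \<Rightarrow> ('v state \<Rightarrow> 'v pmf) \<Rightarrow> bool" where
  "robber_strategy E \<sigma>3 \<longleftrightarrow>
     (\<forall>x1 x2 x3 u. set_pmf (\<sigma>3 (Pos x1 x2 x3 u)) \<subseteq> closed_nbhd E x3)"

(* The distribution Pr(. | s, a1, a2); the action of the cop who is not to move is forced and
   hence ignored. *)
fun transition :: "('v state \<Rightarrow> 'v pmf) \<Rightarrow> 'v state \<Rightarrow> 'v \<Rightarrow> 'v \<Rightarrow> 'v state pmf" where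
  "transition \<sigma>3 Tau a1 a2 = return_pmf Tau"
| "transition \<sigma>3 (Pos x1 x2 x3 C1) a1 a2 =
     (if capture (Pos x1 x2 x3 C1) then return_pmf Tau
      else return_pmf (Pos a1 x2 x3 C2))"
| "transition \<sigma>3 (Pos x1 x2 x3 C2) a1 a2 =
     (if capture (Pos x1 x2 x3 C2) then return_pmf Tau
      else if a2 = x3 then return_pmf (Pos x1 x3 x3 C1)
      else map_pmf (\<lambda>a3. Pos x1 a2 a3 C1) (\<sigma>3 (Pos x1 x2 x3 C2)))"

(* Actions at Tau have no effect, so they are left unconstrained. *)
fun actions :: "('v \<Rightarrow> 'v \<Rightarrow> bool) \<Rightarrow> cop \<Rightarrow> 'v state \<Rightarrow> 'v set" where
  "actions E C1 (Pos x1 x2 x3 u) = (if u = C1 then closed_nbhd E x1 else {x1})"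
| "actions E C2 (Pos x1 x2 x3 u) = (if u = C2 then closed_nbhd E x2 else {x2})"
| "actions E c Tau = UNIV"

(* A strategy maps a history s_0, ..., s_t, listed in order of time, to a distribution of the
   action at time t. Past actions that had any effect can be read off the states. *)
type_synonym 'v strategy = "'v state list \<Rightarrow> 'v pmf"

definition strategies :: "('v \<Rightarrow> 'v \<Rightarrow> bool) \<Rightarrow> cop \<Rightarrow> 'v strategy set" where
  "strategies E c = {\<sigma>. \<forall>h s. set_pmf (\<sigma> (h @ [s])) \<subseteq> actions E c s}"

definition next_state ::
  "('v state \<Rightarrow> 'v pmf) \<Rightarrow> 'v strategy \<Rightarrow> 'v strategy \<Rightarrow> 'v state list \<Rightarrow> 'v state pmf" where
  "next_state \<sigma>3 \<sigma>1 \<sigma>2 h =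
     bind_pmf (\<sigma>1 h) (\<lambda>a1. bind_pmf (\<sigma>2 h) (\<lambda>a2. transition \<sigma>3 (last h) a1 a2))"

(* The conditional distribution of s_n given the values of s_0, ..., s_{n-1}. *)
definition play_kernel ::
  "('v state \<Rightarrow> 'v pmf) \<Rightarrow> 'v strategy \<Rightarrow> 'v strategy \<Rightarrow> 'v state \<Rightarrow>
     nat \<Rightarrow> (nat \<Rightarrow> 'v state) \<Rightarrow> 'v state measure" where
  "play_kernel \<sigma>3 \<sigma>1 \<sigma>2 s0 n \<omega> =
     measure_pmf (if n = 0 then return_pmf s0 else next_state \<sigma>3 \<sigma>1 \<sigma>2 (map \<omega> [0..<n]))"

lemma Ionescu_Tulcea_play_kernel:
  "Ionescu_Tulcea (play_kernel \<sigma>3 \<sigma>1 \<sigma>2 (s0 :: 'v::finite state)) (\<lambda>_. count_space UNIV)"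
proof (rule Ionescu_Tulcea.intro)
  fix i :: nat
  have "PiM {0..<i} (\<lambda>_. count_space UNIV) =
      count_space (PiE {0..<i} (\<lambda>_. UNIV :: 'v state set))"
    by (rule count_space_PiM_finite) auto
  then show "play_kernel \<sigma>3 \<sigma>1 \<sigma>2 s0 i
      \<in> measurable (PiM {0..<i} (\<lambda>_. count_space UNIV)) (subprob_algebra (count_space UNIV))"
    by (simp add: play_kernel_def measure_pmf_in_subprob_algebra)
next
  fix i :: nat and x :: "nat \<Rightarrow> 'v state"
  show "prob_space (play_kernel \<sigma>3 \<sigma>1 \<sigma>2 s0 i x)"
    unfolding play_kernel_def by (rule prob_space_measure_pmf)
qed

(* The law of the infinite play (s_t), given by the Ionescu-Tulcea theorem. *)
definition play ::
  "('v state \<Rightarrow> 'v pmf) \<Rightarrow> 'v strategy \<Rightarrow> 'v strategy \<Rightarrow> 'v::finite state \<Rightarrow>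
     (nat \<Rightarrow> 'v state) measure" where
  "play \<sigma>3 \<sigma>1 \<sigma>2 s0 =
     projective_family.lim UNIV
       (Ionescu_Tulcea.CI (play_kernel \<sigma>3 \<sigma>1 \<sigma>2 s0) (\<lambda>_. count_space UNIV)) (\<lambda>_. count_space UNIV)"

definition J ::
  "('v state \<Rightarrow> 'v pmf) \<Rightarrow> 'v strategy \<Rightarrow> 'v strategy \<Rightarrow> 'v::finite state \<Rightarrow> real" where
  "J \<sigma>3 \<sigma>1 \<sigma>2 s0 = (\<integral>\<omega>. (\<Sum>t. payoff (\<omega> t)) \<partial>play \<sigma>3 \<sigma>1 \<sigma>2 s0)"

definition is_value ::
  "('v \<Rightarrow> 'v \<Rightarrow> bool) \<Rightarrow> ('v state \<Rightarrow> 'v pmf) \<Rightarrow> 'v::finite state \<Rightarrow> real \<Rightarrow> bool" where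
  "is_value E \<sigma>3 s0 v \<longleftrightarrow>
     (SUP \<sigma>1\<in>strategies E C1. INF \<sigma>2\<in>strategies E C2. ereal (J \<sigma>3 \<sigma>1 \<sigma>2 s0)) = ereal v \<and>
     (INF \<sigma>2\<in>strategies E C2. SUP \<sigma>1\<in>strategies E C1. ereal (J \<sigma>3 \<sigma>1 \<sigma>2 s0)) = ereal v"

fun val_iter ::
  "('v \<Rightarrow> 'v \<Rightarrow> bool) \<Rightarrow> ('v state \<Rightarrow> 'v pmf) \<Rightarrow> nat \<Rightarrow> 'v::finite state \<Rightarrow> real" where
  "val_iter E \<sigma>3 i Tau = 0"
| "val_iter E \<sigma>3 0 (Pos x1 x2 x3 u) = payoff (Pos x1 x2 x3 u)"
| "val_iter E \<sigma>3 (Suc i) (Pos x1 x2 x3 C1) =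
     (MAX a1\<in>closed_nbhd E x1. payoff (Pos x1 x2 x3 C1) +
        (\<Sum>s'\<in>UNIV. pmf (transition \<sigma>3 (Pos x1 x2 x3 C1) a1 x2) s' * val_iter E \<sigma>3 i s'))"
| "val_iter E \<sigma>3 (Suc i) (Pos x1 x2 x3 C2) =
     (MIN a2\<in>closed_nbhd E x2. payoff (Pos x1 x2 x3 C2) +
        (\<Sum>s'\<in>UNIV. pmf (transition \<sigma>3 (Pos x1 x2 x3 C2) x1 a2) s' * val_iter E \<sigma>3 i s'))"

end

theory Submission
  imports Defs
begin

text \<open>The iterates increase and are bounded by 1, hence converge to some \<open>v\<close>. The first cop
  guarantees the \<open>n\<close>-th iterate by playing optimally in the game truncated after \<open>n\<close> moves, which
  loses nothing because payoffs are nonnegative. The second cop guarantees \<open>v\<close> by a stationary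
  strategy that minimizes the expected value of \<open>v\<close> after the next move: payoff collected so far
  plus \<open>v\<close> of the current state is then a supermartingale.\<close>

section \<open>Law of the play and its one-step disintegration\<close>

text \<open>By Ionescu-Tulcea the first \<open>n\<close> states are distributed according to the
  composition \<open>IT.C 0 n\<close> of the kernels. The integrand reads only coordinates below
  \<open>n\<close>, and with finitely many states every function of these is measurable, so
  \<open>G\<close> may be arbitrary.\<close>

lemma nn_integral_play_prefix:
  fixes s0 :: "'v::finite state" and G :: "'v state list \<Rightarrow> ennreal"
  shows "(\<integral>\<^sup>+\<omega>. G (map \<omega> [0..<n]) \<partial>play \<sigma>3 \<sigma>1 \<sigma>2 s0) =
    (\<integral>\<^sup>+\<omega>. G (map \<omega> [0..<n])
       \<partial>Ionescu_Tulcea.C (play_kernel \<sigma>3 \<sigma>1 \<sigma>2 s0) (\<lambda>_. count_space UNIV) 0 n (\<lambda>_. undefined))"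
proof -
  interpret IT: Ionescu_Tulcea "play_kernel \<sigma>3 \<sigma>1 \<sigma>2 s0" "\<lambda>_. count_space UNIV"
    by (rule Ionescu_Tulcea_play_kernel)
  let ?M = "\<lambda>_::nat. count_space (UNIV :: 'v state set)"
  let ?r = "\<lambda>\<omega> :: nat \<Rightarrow> 'v state. restrict \<omega> {0..<n}"
  let ?F = "\<lambda>\<omega>. G (map \<omega> [0..<n])"
  have PiM: "PiM {0..<n} ?M = count_space (PiE {0..<n} (\<lambda>_. UNIV))"
    by (rule count_space_PiM_finite) auto
  have F[measurable]: "?F \<in> borel_measurable (PiM {0..<n} ?M)"
    unfolding PiM by simp
  have F_r: "?F (?r \<omega>) = ?F \<omega>" for \<omega>
    by (rule arg_cong[of _ _ G]) simp
  \<comment> \<open>\<open>emeasure_CI\<close> evaluates \<open>IT.CI\<close> by embedding a set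
    into the product over an initial segment of times; here the index set already is that segment
    and the embedding is the identity.\<close>
  have "IT.CI {0..<n} = IT.C 0 n (\<lambda>_. undefined)"
  proof (rule measure_eqI)
    show "emeasure (IT.CI {0..<n}) X = emeasure (IT.C 0 n (\<lambda>_. undefined)) X"
      if "X \<in> sets (IT.CI {0..<n})" for X
    proof -
      have X: "X \<in> sets (PiM {0..<n} ?M)"
        using that by (simp add: IT.PF.sets_P)
      then have "IT.PF.emb {0..<n} {0..<n} X = X"
        using sets.sets_into_space[OF X] by (intro prod_emb_id) (simp add: space_PiM)
      then show ?thesis
        using IT.emeasure_CI[OF order_refl X] by simp
    qed
  qed (simp add: IT.PF.sets_P IT.sets_C)
  then have "distr IT.PF.lim (PiM {0..<n} ?M) ?r = IT.C 0 n (\<lambda>_. undefined)"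
    by (subst IT.distr_lim) auto
  then have "integral\<^sup>N (IT.C 0 n (\<lambda>_. undefined)) ?F =
      integral\<^sup>N (distr IT.PF.lim (PiM {0..<n} ?M) ?r) ?F"
    by simp
  also have "\<dots> = (\<integral>\<^sup>+\<omega>. ?F (?r \<omega>) \<partial>IT.PF.lim)"
    by (subst nn_integral_distr) (auto simp: measurable_cong_sets[OF IT.PF.sets_lim refl]
        intro!: measurable_restrict_subset)
  finally show ?thesis
    unfolding play_def F_r by simp
qed

text \<open>This is conditioning on the history: \<open>IT.C 0 (Suc n)\<close> binds
  \<open>IT.C 0 n\<close> with the kernel \<open>IT.eP n\<close>, which adds the state at time
  \<open>n\<close>. The prefix lemma, used once in each direction, transfers this to the infinite
  play. For \<open>n = 0\<close> the history is empty and the kernel is the point mass at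
  \<open>s0\<close>.\<close>

lemma nn_integral_play_Suc:
  fixes s0 :: "'v::finite state" and G :: "'v state list \<Rightarrow> ennreal"
  shows "(\<integral>\<^sup>+\<omega>. G (map \<omega> [0..<Suc n]) \<partial>play \<sigma>3 \<sigma>1 \<sigma>2 s0) =
    (\<integral>\<^sup>+\<omega>. (\<integral>\<^sup>+y. G (map \<omega> [0..<n] @ [y])
        \<partial>(if n = 0 then return_pmf s0 else next_state \<sigma>3 \<sigma>1 \<sigma>2 (map \<omega> [0..<n])))
      \<partial>play \<sigma>3 \<sigma>1 \<sigma>2 s0)"
proof -
  interpret IT: Ionescu_Tulcea "play_kernel \<sigma>3 \<sigma>1 \<sigma>2 s0" "\<lambda>_. count_space UNIV"
    by (rule Ionescu_Tulcea_play_kernel)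
  let ?M = "\<lambda>_::nat. count_space (UNIV :: 'v state set)"
  let ?K = "\<lambda>h. if n = 0 then return_pmf s0 else next_state \<sigma>3 \<sigma>1 \<sigma>2 h"
  let ?F = "\<lambda>\<omega>. G (map \<omega> [0..<Suc n])"
  have PiM: "PiM {0..<Suc n} ?M = count_space (PiE {0..<Suc n} (\<lambda>_. UNIV))"
    by (rule count_space_PiM_finite) auto
  have F[measurable]: "?F \<in> borel_measurable (PiM {0..<Suc n} ?M)"
    unfolding PiM by simp
  have space: "space (IT.C 0 n (\<lambda>_. undefined)) = space (PiM {0..<n} ?M)"
    by (subst IT.space_C) auto
  have "(\<integral>\<^sup>+\<omega>. ?F \<omega> \<partial>play \<sigma>3 \<sigma>1 \<sigma>2 s0) = (\<integral>\<^sup>+\<omega>. ?F \<omega> \<partial>IT.C 0 (Suc n) (\<lambda>_. undefined))"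
    by (rule nn_integral_play_prefix)
  also have "\<dots> = (\<integral>\<^sup>+\<omega>. \<integral>\<^sup>+\<omega>'. ?F \<omega>' \<partial>IT.eP n \<omega> \<partial>IT.C 0 n (\<lambda>_. undefined))"
    unfolding IT.C.simps add_0_left
    by (rule nn_integral_bind[OF F])
      (use IT.measurable_eP in \<open>simp add: measurable_cong_sets[OF IT.sets_C refl]\<close>)
  also have "\<dots> = (\<integral>\<^sup>+\<omega>. \<integral>\<^sup>+y. ?F (fun_upd \<omega> n y) \<partial>play_kernel \<sigma>3 \<sigma>1 \<sigma>2 s0 n \<omega>
      \<partial>IT.C 0 n (\<lambda>_. undefined))"
    by (rule nn_integral_cong) (simp add: space IT.nn_integral_eP[OF _ F] del: upt_Suc)
  also have "\<dots> = (\<integral>\<^sup>+\<omega>. (\<lambda>h. \<integral>\<^sup>+y. G (h @ [y]) \<partial>?K h) (map \<omega> [0..<n])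
      \<partial>IT.C 0 n (\<lambda>_. undefined))"
    by (intro nn_integral_cong) (simp add: play_kernel_def)
  also have "\<dots> = (\<integral>\<^sup>+\<omega>. (\<lambda>h. \<integral>\<^sup>+y. G (h @ [y]) \<partial>?K h) (map \<omega> [0..<n]) \<partial>play \<sigma>3 \<sigma>1 \<sigma>2 s0)"
    by (rule nn_integral_play_prefix[symmetric])
  finally show ?thesis .
qed

lemma prob_space_play: "prob_space (play \<sigma>3 \<sigma>1 \<sigma>2 (s0 :: 'v::finite state))"
proof
  interpret IT: Ionescu_Tulcea "play_kernel \<sigma>3 \<sigma>1 \<sigma>2 s0" "\<lambda>_. count_space UNIV"
    by (rule Ionescu_Tulcea_play_kernel)
  show "emeasure (play \<sigma>3 \<sigma>1 \<sigma>2 s0) (space (play \<sigma>3 \<sigma>1 \<sigma>2 s0)) = 1"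
    using nn_integral_play_prefix[where G = "\<lambda>_. 1" and n = 0 and ?s0.0 = s0]
      prob_space.emeasure_space_1[OF IT.prob_space_C[of "\<lambda>_. undefined" 0 0]]
    by simp
qed

lemma measurable_play[measurable]:
  "(\<lambda>\<omega>. f (\<omega> t)) \<in> borel_measurable (play \<sigma>3 \<sigma>1 \<sigma>2 (s0 :: 'v::finite state))"
proof -
  interpret IT: Ionescu_Tulcea "play_kernel \<sigma>3 \<sigma>1 \<sigma>2 s0" "\<lambda>_. count_space UNIV"
    by (rule Ionescu_Tulcea_play_kernel)
  have "(\<lambda>\<omega>. f (\<omega> t)) \<in> borel_measurable (PiM UNIV (\<lambda>_. count_space (UNIV :: 'v state set)))"
    by measurable
  then show ?thesis
    unfolding play_def by (simp add: measurable_cong_sets[OF IT.PF.sets_lim refl])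
qed

lemma nn_integral_play_start:
  "(\<integral>\<^sup>+\<omega>. f (\<omega> 0) \<partial>play \<sigma>3 \<sigma>1 \<sigma>2 (s0 :: 'v::finite state)) = f s0"
  using nn_integral_play_Suc[where G = "\<lambda>h. f (last h)" and n = 0]
    prob_space.emeasure_space_1[OF prob_space_play[of \<sigma>3 \<sigma>1 \<sigma>2 s0]]
  by (simp add: nn_integral_return)

lemma nn_integral_play_step:
  "(\<integral>\<^sup>+\<omega>. f (\<omega> (Suc n)) \<partial>play \<sigma>3 \<sigma>1 \<sigma>2 (s0 :: 'v::finite state)) =
   (\<integral>\<^sup>+\<omega>. (\<integral>\<^sup>+y. f y \<partial>next_state \<sigma>3 \<sigma>1 \<sigma>2 (map \<omega> [0..<Suc n])) \<partial>play \<sigma>3 \<sigma>1 \<sigma>2 s0)"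
  using nn_integral_play_Suc[where G = "\<lambda>h. f (last h)" and n = "Suc n"] by simp

text \<open>One integral over histories allows an inequality assumed for each single history to be
  integrated. Additivity needs measurability of functions of the whole prefix, which is immediate on
  its discrete space; hence the detour through \<open>IT.C\<close>.\<close>

lemma nn_integral_play_add:
  fixes f g :: "'v::finite state \<Rightarrow> ennreal"
  shows "(\<integral>\<^sup>+\<omega>. g (\<omega> n) \<partial>play \<sigma>3 \<sigma>1 \<sigma>2 s0) + (\<integral>\<^sup>+\<omega>. f (\<omega> (Suc n)) \<partial>play \<sigma>3 \<sigma>1 \<sigma>2 s0) =
   (\<integral>\<^sup>+\<omega>. (\<lambda>h. g (last h) + (\<integral>\<^sup>+y. f y \<partial>next_state \<sigma>3 \<sigma>1 \<sigma>2 h)) (map \<omega> [0..<Suc n])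
      \<partial>play \<sigma>3 \<sigma>1 \<sigma>2 s0)"
proof -
  interpret IT: Ionescu_Tulcea "play_kernel \<sigma>3 \<sigma>1 \<sigma>2 s0" "\<lambda>_. count_space UNIV"
    by (rule Ionescu_Tulcea_play_kernel)
  let ?C = "IT.C 0 (Suc n) (\<lambda>_. undefined)"
  have PiM: "PiM {0..<Suc n} (\<lambda>_. count_space UNIV) =
      count_space (PiE {0..<Suc n} (\<lambda>_. UNIV :: 'v state set))"
    by (rule count_space_PiM_finite) auto
  have sets: "sets ?C = sets (count_space (PiE {0..<Suc n} (\<lambda>_. UNIV :: 'v state set)))"
    unfolding PiM[symmetric] by (subst IT.sets_C) auto
  have meas: "F \<in> borel_measurable ?C" for F :: "(nat \<Rightarrow> 'v state) \<Rightarrow> ennreal"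
    unfolding measurable_cong_sets[OF sets refl] by simp
  have "(\<integral>\<^sup>+\<omega>. g (\<omega> n) \<partial>play \<sigma>3 \<sigma>1 \<sigma>2 s0) =
      (\<integral>\<^sup>+\<omega>. (\<lambda>h. g (last h)) (map \<omega> [0..<Suc n]) \<partial>play \<sigma>3 \<sigma>1 \<sigma>2 s0)"
    by simp
  then show ?thesis
    unfolding nn_integral_play_step
      nn_integral_play_prefix[where G = "\<lambda>h. g (last h)" and n = "Suc n"]
      nn_integral_play_prefix[where G = "\<lambda>h. \<integral>\<^sup>+y. f y \<partial>next_state \<sigma>3 \<sigma>1 \<sigma>2 h" and n = "Suc n"]
      nn_integral_play_prefix[where G = "\<lambda>h. g (last h) + (\<integral>\<^sup>+y. f y \<partial>next_state \<sigma>3 \<sigma>1 \<sigma>2 h)" and n = "Suc n"]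
    by (simp add: nn_integral_add[OF meas meas] del: upt_Suc IT.C.simps)
qed

section \<open>Bounds on the total payoff by potentials\<close>

text \<open>The payoff collected before time \<open>n\<close> plus \<open>W\<close> at time
  \<open>n\<close> is a supermartingale starting at \<open>W s0\<close>. Dropping the nonnegative
  term in \<open>W\<close> bounds every partial sum, hence the series.\<close>

lemma expected_payoff_le_potential:
  fixes W :: "'v::finite state \<Rightarrow> ennreal"
  assumes "\<And>h. h \<noteq> [] \<Longrightarrow>
    ennreal (payoff (last h)) + (\<integral>\<^sup>+y. W y \<partial>next_state \<sigma>3 \<sigma>1 \<sigma>2 h) \<le> W (last h)"
  shows "(\<Sum>t. \<integral>\<^sup>+\<omega>. ennreal (payoff (\<omega> t)) \<partial>play \<sigma>3 \<sigma>1 \<sigma>2 s0) \<le> W s0"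
proof -
  let ?P = "play \<sigma>3 \<sigma>1 \<sigma>2 s0"
  let ?e = "\<lambda>t. \<integral>\<^sup>+\<omega>. ennreal (payoff (\<omega> t)) \<partial>?P"
  have "(\<Sum>t<n. ?e t) + (\<integral>\<^sup>+\<omega>. W (\<omega> n) \<partial>?P) \<le> W s0" for n
  proof (induction n)
    case 0
    then show ?case by (simp add: nn_integral_play_start)
  next
    case (Suc n)
    have "?e n + (\<integral>\<^sup>+\<omega>. W (\<omega> (Suc n)) \<partial>?P) \<le> (\<integral>\<^sup>+\<omega>. W (last (map \<omega> [0..<Suc n])) \<partial>?P)"
      unfolding nn_integral_play_add[where g = "\<lambda>s. ennreal (payoff s)"]
      by (rule nn_integral_mono, rule assms) simp
    then have "?e n + (\<integral>\<^sup>+\<omega>. W (\<omega> (Suc n)) \<partial>?P) \<le> (\<integral>\<^sup>+\<omega>. W (\<omega> n) \<partial>?P)"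
      by simp
    then have "(\<Sum>t<n. ?e t) + (?e n + (\<integral>\<^sup>+\<omega>. W (\<omega> (Suc n)) \<partial>?P)) \<le>
        (\<Sum>t<n. ?e t) + (\<integral>\<^sup>+\<omega>. W (\<omega> n) \<partial>?P)"
      by (rule add_left_mono)
    also note Suc.IH
    finally show ?case
      by (simp add: add.assoc)
  qed
  then have "(\<Sum>t<n. ?e t) \<le> W s0" for n
    by (meson le_iff_add order_trans)
  then show ?thesis
    unfolding suminf_eq_SUP by (rule SUP_least)
qed

text \<open>The submartingale counterpart, with a potential that depends on time because the
  truncated game has a shrinking horizon. Nothing is asked beyond time \<open>n\<close>, since later
  payoffs are nonnegative. A history of length \<open>Suc t\<close> ends in the state at time
  \<open>t\<close>.\<close>

lemma potential_le_expected_payoff: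
  fixes W :: "nat \<Rightarrow> 'v::finite state \<Rightarrow> ennreal"
  assumes "\<And>h t. length h = Suc t \<Longrightarrow> t < n \<Longrightarrow>
    W t (last h) \<le> ennreal (payoff (last h)) + (\<integral>\<^sup>+y. W (Suc t) y \<partial>next_state \<sigma>3 \<sigma>1 \<sigma>2 h)"
    and "\<And>s. W n s \<le> ennreal (payoff s)"
  shows "W 0 s0 \<le> (\<Sum>t. \<integral>\<^sup>+\<omega>. ennreal (payoff (\<omega> t)) \<partial>play \<sigma>3 \<sigma>1 \<sigma>2 s0)"
proof -
  let ?P = "play \<sigma>3 \<sigma>1 \<sigma>2 s0"
  let ?e = "\<lambda>t. \<integral>\<^sup>+\<omega>. ennreal (payoff (\<omega> t)) \<partial>?P"
  have "W 0 s0 \<le> (\<Sum>t<k. ?e t) + (\<integral>\<^sup>+\<omega>. W k (\<omega> k) \<partial>?P)" if "k \<le> n" for k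
    using that
  proof (induction k)
    case 0
    then show ?case by (simp add: nn_integral_play_start)
  next
    case (Suc k)
    have "(\<integral>\<^sup>+\<omega>. W k (last (map \<omega> [0..<Suc k])) \<partial>?P) \<le> ?e k + (\<integral>\<^sup>+\<omega>. W (Suc k) (\<omega> (Suc k)) \<partial>?P)"
      unfolding nn_integral_play_add[where g = "\<lambda>s. ennreal (payoff s)"]
      by (rule nn_integral_mono, rule assms(1)) (use Suc.prems in simp_all)
    then have "(\<integral>\<^sup>+\<omega>. W k (\<omega> k) \<partial>?P) \<le> ?e k + (\<integral>\<^sup>+\<omega>. W (Suc k) (\<omega> (Suc k)) \<partial>?P)"
      by simp
    then have "(\<Sum>t<k. ?e t) + (\<integral>\<^sup>+\<omega>. W k (\<omega> k) \<partial>?P) \<le>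
        (\<Sum>t<k. ?e t) + (?e k + (\<integral>\<^sup>+\<omega>. W (Suc k) (\<omega> (Suc k)) \<partial>?P))"
      by (rule add_left_mono)
    with Suc have "W 0 s0 \<le> (\<Sum>t<k. ?e t) + (?e k + (\<integral>\<^sup>+\<omega>. W (Suc k) (\<omega> (Suc k)) \<partial>?P))"
      by (meson Suc_leD order_trans)
    then show ?case
      by (simp add: add.assoc)
  qed
  from this[of n] have "W 0 s0 \<le> (\<Sum>t<n. ?e t) + (\<integral>\<^sup>+\<omega>. W n (\<omega> n) \<partial>?P)"
    by simp
  \<comment> \<open>The potential left over at the horizon is absorbed by the payoff at time
    \<open>n\<close>, so the partial sum gains one index.\<close>
  also have "\<dots> \<le> (\<Sum>t<n. ?e t) + ?e n"
    by (intro add_left_mono nn_integral_mono assms(2))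
  also have "\<dots> = (\<Sum>t<Suc n. ?e t)"
    by simp
  also have "\<dots> \<le> (\<Sum>t. ?e t)"
    unfolding suminf_eq_SUP by (rule SUP_upper) simp
  finally show ?thesis .
qed

section \<open>Finiteness of the expected payoff\<close>

lemma payoff_nonneg: "0 \<le> payoff s"
  by (simp add: payoff_def)

lemma transition_capture: "capture s \<Longrightarrow> transition \<sigma>3 s a1 a2 = return_pmf Tau"
  by (cases "(\<sigma>3, s, a1, a2)" rule: transition.cases) auto

lemma nn_integral_pmf_le:
  assumes "\<And>x. x \<in> set_pmf p \<Longrightarrow> f x \<le> (c :: ennreal)"
  shows "(\<integral>\<^sup>+x. f x \<partial>measure_pmf p) \<le> c"
proof -
  have "(\<integral>\<^sup>+x. f x \<partial>measure_pmf p) \<le> (\<integral>\<^sup>+x. c \<partial>measure_pmf p)"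
    by (rule nn_integral_mono_AE) (use assms in \<open>simp add: AE_measure_pmf_iff\<close>)
  then show ?thesis by simp
qed

lemma nn_integral_pmf_ge:
  assumes "\<And>x. x \<in> set_pmf p \<Longrightarrow> (c :: ennreal) \<le> f x"
  shows "c \<le> (\<integral>\<^sup>+x. f x \<partial>measure_pmf p)"
proof -
  have "(\<integral>\<^sup>+x. c \<partial>measure_pmf p) \<le> (\<integral>\<^sup>+x. f x \<partial>measure_pmf p)"
    by (rule nn_integral_mono_AE) (use assms in \<open>simp add: AE_measure_pmf_iff\<close>)
  then show ?thesis by simp
qed

text \<open>The constant payoff moves under the integrals because all distributions involved have
  mass 1. The one-step conditions on potentials then need checking only for pairs of actions in the
  supports.\<close>

lemma payoff_add_nn_integral_next_state:
  "ennreal (payoff (last h)) + (\<integral>\<^sup>+y. W y \<partial>next_state \<sigma>3 \<sigma>1 \<sigma>2 h) =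
    (\<integral>\<^sup>+a1. \<integral>\<^sup>+a2. (ennreal (payoff (last h)) + (\<integral>\<^sup>+y. W y \<partial>transition \<sigma>3 (last h) a1 a2))
      \<partial>\<sigma>2 h \<partial>\<sigma>1 h)"
  by (simp add: next_state_def nn_integral_add)

text \<open>The potential is 1 before \<open>Tau\<close> and 0 at \<open>Tau\<close>. A state with
  payoff 1 is a capture state and moves to \<open>Tau\<close> at once, so the drop of the potential
  covers the payoff.\<close>

lemma nn_integral_suminf_payoff_le_1:
  "(\<Sum>t. \<integral>\<^sup>+\<omega>. ennreal (payoff (\<omega> t)) \<partial>play \<sigma>3 \<sigma>1 \<sigma>2 (s0 :: 'v::finite state)) \<le> 1"
proof -
  let ?W = "\<lambda>s :: 'v state. if s = Tau then 0 else 1 :: ennreal"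
  have "ennreal (payoff s) + (\<integral>\<^sup>+y. ?W y \<partial>transition \<sigma>3 s a1 a2) \<le> ?W s" for s a1 a2
  proof (cases "capture s \<or> s = Tau")
    case True
    then have "transition \<sigma>3 s a1 a2 = return_pmf Tau"
      using transition_capture by force
    with True show ?thesis
      by (auto simp: payoff_def capture_def nn_integral_return)
  next
    case False
    then have "payoff s = 0"
      by (simp add: payoff_def capture_def)
    with False show ?thesis
      by (auto intro!: nn_integral_pmf_le)
  qed
  then have "(\<Sum>t. \<integral>\<^sup>+\<omega>. ennreal (payoff (\<omega> t)) \<partial>play \<sigma>3 \<sigma>1 \<sigma>2 s0) \<le> ?W s0"
    by (intro expected_payoff_le_potential)
      (unfold payoff_add_nn_integral_next_state, intro nn_integral_pmf_le)
  also have "\<dots> \<le> 1" by simp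
  finally show ?thesis .
qed

text \<open>\<open>J\<close> integrates a real series, while the potential bounds concern a series
  of nonnegative extended integrals. Finiteness of the latter yields almost sure summability,
  without which the real \<open>suminf\<close> would say nothing about the payoffs.\<close>

lemma ennreal_J:
  "ennreal (J \<sigma>3 \<sigma>1 \<sigma>2 s0) =
    (\<Sum>t. \<integral>\<^sup>+\<omega>. ennreal (payoff (\<omega> t)) \<partial>play \<sigma>3 \<sigma>1 \<sigma>2 (s0 :: 'v::finite state))"
  and J_nonneg: "0 \<le> J \<sigma>3 \<sigma>1 \<sigma>2 s0"
proof -
  let ?P = "play \<sigma>3 \<sigma>1 \<sigma>2 s0"
  have sum: "(\<integral>\<^sup>+\<omega>. (\<Sum>t. ennreal (payoff (\<omega> t))) \<partial>?P) =
      (\<Sum>t. \<integral>\<^sup>+\<omega>. ennreal (payoff (\<omega> t)) \<partial>?P)"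
    by (rule nn_integral_suminf) simp
  have fin: "(\<integral>\<^sup>+\<omega>. (\<Sum>t. ennreal (payoff (\<omega> t))) \<partial>?P) \<noteq> \<infinity>"
    unfolding sum using nn_integral_suminf_payoff_le_1[of \<sigma>3 \<sigma>1 \<sigma>2 s0]
    by (auto simp: top_unique)
  have "AE \<omega> in ?P. (\<Sum>t. ennreal (payoff (\<omega> t))) \<noteq> \<infinity>"
    by (rule nn_integral_PInf_AE[OF _ fin]) measurable
  then have summable: "AE \<omega> in ?P. summable (\<lambda>t. payoff (\<omega> t))"
    by eventually_elim (auto intro!: summable_suminf_not_top payoff_nonneg)
  have nn: "(\<integral>\<^sup>+\<omega>. ennreal (\<Sum>t. payoff (\<omega> t)) \<partial>?P) = (\<Sum>t. \<integral>\<^sup>+\<omega>. ennreal (payoff (\<omega> t)) \<partial>?P)"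
    unfolding sum[symmetric] using summable
    by (intro nn_integral_cong_AE, eventually_elim)
      (simp add: suminf_ennreal2 payoff_nonneg)
  have nonneg: "AE \<omega> in ?P. 0 \<le> (\<Sum>t. payoff (\<omega> t))"
    using summable by eventually_elim (intro suminf_nonneg payoff_nonneg)
  have "J \<sigma>3 \<sigma>1 \<sigma>2 s0 = enn2real (\<integral>\<^sup>+\<omega>. ennreal (\<Sum>t. payoff (\<omega> t)) \<partial>?P)"
    unfolding J_def by (rule integral_eq_nn_integral[OF _ nonneg]) measurable
  then show "ennreal (J \<sigma>3 \<sigma>1 \<sigma>2 s0) = (\<Sum>t. \<integral>\<^sup>+\<omega>. ennreal (payoff (\<omega> t)) \<partial>?P)"
    and "0 \<le> J \<sigma>3 \<sigma>1 \<sigma>2 s0"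
    using fin unfolding nn sum by (auto simp: less_top)
qed

section \<open>One-step optimality and the iterates\<close>

text \<open>The bracket of the recursion with an arbitrary continuation \<open>f\<close>, to be
  applied to the iterates and to their limit. Keeping both actions as arguments lets one expression
  serve the states of either cop.\<close>

definition lookahead ::
  "('v state \<Rightarrow> 'v pmf) \<Rightarrow> ('v::finite state \<Rightarrow> real) \<Rightarrow> 'v state \<Rightarrow> 'v \<Rightarrow> 'v \<Rightarrow> real" where
  "lookahead \<sigma>3 f s a1 a2 = payoff s + (\<Sum>s'\<in>UNIV. pmf (transition \<sigma>3 s a1 a2) s' * f s')"

lemma ennreal_lookahead:
  assumes "\<And>s. 0 \<le> f s"
  shows "ennreal (lookahead \<sigma>3 f s a1 a2) =
    ennreal (payoff s) + (\<integral>\<^sup>+y. ennreal (f y) \<partial>transition \<sigma>3 s a1 a2)"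
proof -
  let ?p = "transition \<sigma>3 s a1 a2"
  have "(\<integral>\<^sup>+y. ennreal (f y) \<partial>?p) = (\<Sum>y\<in>UNIV. ennreal (f y) * ennreal (pmf ?p y))"
    by (rule nn_integral_measure_pmf_support) auto
  then show ?thesis
    using assms by (simp add: lookahead_def payoff_nonneg sum_nonneg ennreal_mult mult.commute
      flip: sum_ennreal)
qed

lemma lookahead_mono:
  assumes "\<And>s. f s \<le> g s"
  shows "lookahead \<sigma>3 f s a1 a2 \<le> lookahead \<sigma>3 g s a1 a2"
  unfolding lookahead_def by (intro add_left_mono sum_mono mult_left_mono assms) simp

lemma lookahead_capture:
  "capture s \<or> s = Tau \<Longrightarrow> lookahead \<sigma>3 f s a1 a2 = payoff s + f Tau"
  by (auto simp: lookahead_def transition_capture pmf_return indicator_def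
      if_distrib[of "\<lambda>x. x * _"] cong: if_cong)

text \<open>From a capture state or \<open>Tau\<close> the continuation contributes
  \<open>f Tau = 0\<close>; elsewhere the payoff vanishes and an average of values at most 1
  remains.\<close>

lemma lookahead_le_1:
  assumes "\<And>s. f s \<le> 1" and "f Tau = 0"
  shows "lookahead \<sigma>3 f s a1 a2 \<le> 1"
proof (cases "capture s \<or> s = Tau")
  case True
  then show ?thesis
    by (simp add: lookahead_capture assms(2)) (simp add: payoff_def)
next
  case False
  have "(\<Sum>s'\<in>UNIV. pmf (transition \<sigma>3 s a1 a2) s' * f s') \<le>
      (\<Sum>s'\<in>UNIV. pmf (transition \<sigma>3 s a1 a2) s')"
    by (intro sum_mono) (simp add: assms(1) mult_left_le)
  also have "\<dots> = 1"
    by (rule sum_pmf_eq_1) auto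
  finally show ?thesis
    using False by (simp add: lookahead_def payoff_def capture_def)
qed

lemma closed_nbhd_self: "x \<in> closed_nbhd E x"
  by (simp add: closed_nbhd_def)

lemma val_iter_Suc:
  "val_iter E \<sigma>3 (Suc i) (Pos x1 x2 x3 C1) =
     (MAX a1\<in>closed_nbhd E x1. lookahead \<sigma>3 (val_iter E \<sigma>3 i) (Pos x1 x2 x3 C1) a1 x2)"
  "val_iter E \<sigma>3 (Suc i) (Pos x1 x2 x3 C2) =
     (MIN a2\<in>closed_nbhd E x2. lookahead \<sigma>3 (val_iter E \<sigma>3 i) (Pos x1 x2 x3 C2) x1 a2)"
  by (simp_all add: lookahead_def)

text \<open>In each position one cop chooses and the action of the other is forced, so a maximum or
  minimum over one action set can be read as a condition on pairs of actions. With
  \<open>optimal_action_C2\<close> this spares later proofs the distinction of who moves.\<close>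

lemma optimal_action_C1:
  "\<exists>a1\<in>actions E C1 s. \<forall>a2\<in>actions E C2 s.
     val_iter E \<sigma>3 (Suc i) s \<le> lookahead \<sigma>3 (val_iter E \<sigma>3 i) s a1 a2"
proof (cases s)
  case Tau
  then show ?thesis by (simp add: lookahead_capture payoff_def)
next
  case (Pos x1 x2 x3 u)
  let ?L = "lookahead \<sigma>3 (val_iter E \<sigma>3 i) s"
  show ?thesis
  proof (cases u)
    case C1
    have "(MAX a1\<in>closed_nbhd E x1. ?L a1 x2) \<in> (\<lambda>a1. ?L a1 x2) ` closed_nbhd E x1"
      using closed_nbhd_self[of x1 E] by (intro Max_in) auto
    then obtain a1 where "a1 \<in> closed_nbhd E x1" "val_iter E \<sigma>3 (Suc i) s = ?L a1 x2"
      unfolding Pos C1 val_iter_Suc by blast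
    with Pos C1 show ?thesis by (intro bexI[of _ a1]) auto
  next
    case C2
    have "val_iter E \<sigma>3 (Suc i) s \<le> ?L x1 a2" if "a2 \<in> closed_nbhd E x2" for a2
      unfolding Pos C2 val_iter_Suc using that by (intro Min_le) auto
    with Pos C2 show ?thesis by simp
  qed
qed

lemma optimal_action_C2:
  "\<exists>a2\<in>actions E C2 s. \<forall>a1\<in>actions E C1 s.
     lookahead \<sigma>3 (val_iter E \<sigma>3 i) s a1 a2 \<le> val_iter E \<sigma>3 (Suc i) s"
proof (cases s)
  case Tau
  then show ?thesis by (simp add: lookahead_capture payoff_def)
next
  case (Pos x1 x2 x3 u)
  let ?L = "lookahead \<sigma>3 (val_iter E \<sigma>3 i) s"
  show ?thesis
  proof (cases u)
    case C1
    have "?L a1 x2 \<le> val_iter E \<sigma>3 (Suc i) s" if "a1 \<in> closed_nbhd E x1" for a1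
      unfolding Pos C1 val_iter_Suc using that by (intro Max_ge) auto
    with Pos C1 show ?thesis by simp
  next
    case C2
    have "(MIN a2\<in>closed_nbhd E x2. ?L x1 a2) \<in> (\<lambda>a2. ?L x1 a2) ` closed_nbhd E x2"
      using closed_nbhd_self[of x2 E] by (intro Min_in) auto
    then obtain a2 where "a2 \<in> closed_nbhd E x2" "val_iter E \<sigma>3 (Suc i) s = ?L x1 a2"
      unfolding Pos C2 val_iter_Suc by blast
    with Pos C2 show ?thesis by (intro bexI[of _ a2]) auto
  qed
qed

lemma actions_nonempty: "actions E c s \<noteq> {}"
  by (cases "(E, c, s)" rule: actions.cases) (auto simp: closed_nbhd_def)

text \<open>Pit an optimal action of the first cop for stage \<open>i\<close> against one of the
  second cop for stage \<open>j\<close>: the lookaheads at this pair separate the two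
  iterates.\<close>

lemma val_iter_Suc_mono:
  assumes "\<And>s. val_iter E \<sigma>3 i s \<le> val_iter E \<sigma>3 j s"
  shows "val_iter E \<sigma>3 (Suc i) s \<le> val_iter E \<sigma>3 (Suc j) s"
proof -
  obtain a1 where a1: "a1 \<in> actions E C1 s"
    "\<And>a2. a2 \<in> actions E C2 s \<Longrightarrow> val_iter E \<sigma>3 (Suc i) s \<le> lookahead \<sigma>3 (val_iter E \<sigma>3 i) s a1 a2"
    using optimal_action_C1 by blast
  obtain a2 where a2: "a2 \<in> actions E C2 s"
    "\<And>a1. a1 \<in> actions E C1 s \<Longrightarrow> lookahead \<sigma>3 (val_iter E \<sigma>3 j) s a1 a2 \<le> val_iter E \<sigma>3 (Suc j) s"
    using optimal_action_C2 by blast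
  show ?thesis
    using a1(2)[OF a2(1)] a2(2)[OF a1(1)]
      lookahead_mono[of "val_iter E \<sigma>3 i" "val_iter E \<sigma>3 j" \<sigma>3 s a1 a2, OF assms] by linarith
qed

lemma val_iter_0: "val_iter E \<sigma>3 0 s = payoff s"
  by (cases s) (simp_all add: payoff_def)

lemma val_iter_le_Suc: "val_iter E \<sigma>3 i s \<le> val_iter E \<sigma>3 (Suc i) s"
proof (induction i arbitrary: s)
  case 0
  obtain a2 where a2: "\<And>a1. a1 \<in> actions E C1 s \<Longrightarrow>
      lookahead \<sigma>3 (val_iter E \<sigma>3 0) s a1 a2 \<le> val_iter E \<sigma>3 (Suc 0) s"
    using optimal_action_C2 by blast
  obtain a1 where "a1 \<in> actions E C1 s"
    using actions_nonempty[of E C1 s] by blast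
  \<comment> \<open>A further step only adds a nonnegative expected payoff.\<close>
  moreover have "payoff s \<le> lookahead \<sigma>3 (val_iter E \<sigma>3 0) s a1 a2"
    unfolding lookahead_def val_iter_0 by (simp add: sum_nonneg payoff_nonneg)
  ultimately show ?case
    using a2 unfolding val_iter_0 by force
next
  case (Suc i)
  then show ?case by (rule val_iter_Suc_mono)
qed

lemma incseq_val_iter: "incseq (\<lambda>i. val_iter E \<sigma>3 i s)"
  by (rule incseq_SucI) (rule val_iter_le_Suc)

lemma val_iter_nonneg: "0 \<le> val_iter E \<sigma>3 i s"
  using incseqD[OF incseq_val_iter[of E \<sigma>3 s], of 0 i] payoff_nonneg[of s]
  by (simp add: val_iter_0)

lemma val_iter_le_1: "val_iter E \<sigma>3 i s \<le> 1"
proof (induction i arbitrary: s)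
  case 0
  then show ?case by (simp add: val_iter_0 payoff_def)
next
  case (Suc i)
  obtain a1 where "\<And>a2. a2 \<in> actions E C2 s \<Longrightarrow>
      val_iter E \<sigma>3 (Suc i) s \<le> lookahead \<sigma>3 (val_iter E \<sigma>3 i) s a1 a2"
    using optimal_action_C1 by blast
  moreover obtain a2 where "a2 \<in> actions E C2 s"
    using actions_nonempty[of E C2 s] by blast
  ultimately show ?case
    using lookahead_le_1[of "val_iter E \<sigma>3 i" \<sigma>3 s a1 a2] Suc.IH by force
qed

section \<open>The limit of the iterates\<close>

definition val_lim ::
  "('v \<Rightarrow> 'v \<Rightarrow> bool) \<Rightarrow> ('v state \<Rightarrow> 'v pmf) \<Rightarrow> 'v::finite state \<Rightarrow> real" where
  "val_lim E \<sigma>3 s = lim (\<lambda>i. val_iter E \<sigma>3 i s)"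

lemma val_iter_tendsto: "(\<lambda>i. val_iter E \<sigma>3 i s) \<longlonglongrightarrow> val_lim E \<sigma>3 s"
proof -
  have "convergent (\<lambda>i. val_iter E \<sigma>3 i s)"
    using incseq_convergent[OF incseq_val_iter[of E \<sigma>3 s]] val_iter_le_1
    unfolding convergent_def by metis
  then show ?thesis
    unfolding val_lim_def convergent_LIMSEQ_iff .
qed

lemma val_iter_le_val_lim: "val_iter E \<sigma>3 i s \<le> val_lim E \<sigma>3 s"
  by (rule incseq_le[OF incseq_val_iter val_iter_tendsto])

text \<open>If no action of the second cop worked for the limit, then, by finiteness of the action set,
  none would work for some late iterate, although each iterate has an optimal action.\<close>
lemma optimal_action_C2_val_lim:
  "\<exists>a2\<in>actions E C2 s. \<forall>a1\<in>actions E C1 s.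
     lookahead \<sigma>3 (val_lim E \<sigma>3) s a1 a2 \<le> val_lim E \<sigma>3 s"
proof (rule ccontr)
  assume neg: "\<not> ?thesis"
  have tendsto: "(\<lambda>i. lookahead \<sigma>3 (val_iter E \<sigma>3 i) s a1 a2) \<longlonglongrightarrow>
      lookahead \<sigma>3 (val_lim E \<sigma>3) s a1 a2" for a1 a2
    unfolding lookahead_def by (intro tendsto_intros val_iter_tendsto)
  have "\<forall>a2\<in>actions E C2 s. \<forall>\<^sub>F i in sequentially.
      \<exists>a1\<in>actions E C1 s. val_lim E \<sigma>3 s < lookahead \<sigma>3 (val_iter E \<sigma>3 i) s a1 a2"
  proof
    fix a2 assume "a2 \<in> actions E C2 s"
    with neg obtain a1 where a1: "a1 \<in> actions E C1 s"
      "val_lim E \<sigma>3 s < lookahead \<sigma>3 (val_lim E \<sigma>3) s a1 a2"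
      by (auto simp: not_le)
    from order_tendstoD(1)[OF tendsto a1(2)]
    show "\<forall>\<^sub>F i in sequentially.
        \<exists>a1\<in>actions E C1 s. val_lim E \<sigma>3 s < lookahead \<sigma>3 (val_iter E \<sigma>3 i) s a1 a2"
      by eventually_elim (use a1(1) in blast)
  qed
  then have "\<forall>\<^sub>F i in sequentially. \<forall>a2\<in>actions E C2 s.
      \<exists>a1\<in>actions E C1 s. val_lim E \<sigma>3 s < lookahead \<sigma>3 (val_iter E \<sigma>3 i) s a1 a2"
    by (intro eventually_ball_finite) simp_all
  then obtain i where i: "\<And>a2. a2 \<in> actions E C2 s \<Longrightarrow>
      \<exists>a1\<in>actions E C1 s. val_lim E \<sigma>3 s < lookahead \<sigma>3 (val_iter E \<sigma>3 i) s a1 a2"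
    by (auto simp: eventually_sequentially)
  \<comment> \<open>An optimal action at this stage keeps every lookahead below iterate
    \<open>Suc i\<close>, which lies below the limit by monotonicity; this contradicts the choice of
    \<open>i\<close>.\<close>
  obtain a2 where "a2 \<in> actions E C2 s" and "\<And>a1. a1 \<in> actions E C1 s \<Longrightarrow>
      lookahead \<sigma>3 (val_iter E \<sigma>3 i) s a1 a2 \<le> val_iter E \<sigma>3 (Suc i) s"
    using optimal_action_C2 by blast
  with i val_iter_le_val_lim[of E \<sigma>3 "Suc i" s] show False
    by (meson not_le order_trans)
qed

section \<open>Strategies securing the value\<close>

text \<open>The potential is \<open>val_lim\<close> itself. The action chosen at each state works
  against every legal action there, so the one-step condition survives any history-dependent
  randomization by the first cop.\<close>

lemma strategy_C2_val_lim:
  "\<exists>\<sigma>2\<in>strategies E C2. \<forall>\<sigma>1\<in>strategies E C1. J \<sigma>3 \<sigma>1 \<sigma>2 s0 \<le> val_lim E \<sigma>3 s0"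
proof -
  obtain \<alpha> where \<alpha>: "\<And>s. \<alpha> s \<in> actions E C2 s"
    "\<And>s a1. a1 \<in> actions E C1 s \<Longrightarrow> lookahead \<sigma>3 (val_lim E \<sigma>3) s a1 (\<alpha> s) \<le> val_lim E \<sigma>3 s"
    using optimal_action_C2_val_lim by metis
  define \<sigma>2 where "\<sigma>2 h = return_pmf (\<alpha> (last h))" for h
  have nonneg: "0 \<le> val_lim E \<sigma>3 s" for s
    using val_iter_nonneg val_iter_le_val_lim by (rule order_trans)
  have "J \<sigma>3 \<sigma>1 \<sigma>2 s0 \<le> val_lim E \<sigma>3 s0" if \<sigma>1: "\<sigma>1 \<in> strategies E C1" for \<sigma>1
  proof -
    have "ennreal (J \<sigma>3 \<sigma>1 \<sigma>2 s0) \<le> ennreal (val_lim E \<sigma>3 s0)"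
      unfolding ennreal_J
    proof (rule expected_payoff_le_potential)
      fix h :: "'a state list" assume "h \<noteq> []"
      \<comment> \<open>Legality is required on histories of the form \<open>h @ [s]\<close>, which
        are exactly the nonempty ones.\<close>
      then have "set_pmf (\<sigma>1 h) \<subseteq> actions E C1 (last h)"
        using \<sigma>1 unfolding strategies_def by (metis (mono_tags, lifting) append_butlast_last_id mem_Collect_eq)
      then show "ennreal (payoff (last h)) + (\<integral>\<^sup>+y. ennreal (val_lim E \<sigma>3 y) \<partial>next_state \<sigma>3 \<sigma>1 \<sigma>2 h)
          \<le> ennreal (val_lim E \<sigma>3 (last h))"
        unfolding payoff_add_nn_integral_next_state ennreal_lookahead[OF nonneg, symmetric]
        by (intro nn_integral_pmf_le ennreal_leI) (auto simp: \<sigma>2_def intro!: \<alpha>(2))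
    qed
    then show ?thesis
      using nonneg by simp
  qed
  moreover have "\<sigma>2 \<in> strategies E C2"
    by (simp add: strategies_def \<sigma>2_def \<alpha>(1))
  ultimately show ?thesis by blast
qed

lemma strategy_C1_val_iter:
  "\<exists>\<sigma>1\<in>strategies E C1. \<forall>\<sigma>2\<in>strategies E C2. val_iter E \<sigma>3 n s0 \<le> J \<sigma>3 \<sigma>1 \<sigma>2 s0"
proof -
  obtain \<alpha> where \<alpha>: "\<And>i s. \<alpha> i s \<in> actions E C1 s"
    "\<And>i s a2. a2 \<in> actions E C2 s \<Longrightarrow>
      val_iter E \<sigma>3 (Suc i) s \<le> lookahead \<sigma>3 (val_iter E \<sigma>3 i) s (\<alpha> i s) a2"
    using optimal_action_C1 by metis
  \<comment> \<open>At time \<open>t\<close> the history has length \<open>Suc t\<close>, so the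
    index is \<open>n - Suc t\<close>, the stage of the continuation. Beyond length
    \<open>n\<close>, truncated subtraction gives index 0: just some legal action, at times the
    estimate ignores.\<close>
  define \<sigma>1 where "\<sigma>1 h = return_pmf (\<alpha> (n - length h) (last h))" for h
  have "val_iter E \<sigma>3 n s0 \<le> J \<sigma>3 \<sigma>1 \<sigma>2 s0" if \<sigma>2: "\<sigma>2 \<in> strategies E C2" for \<sigma>2
  proof -
    \<comment> \<open>The term \<open>n - 0\<close> matches the potential at time 0; at time
      \<open>n\<close> the potential is iterate 0, the payoff.\<close>
    have "ennreal (val_iter E \<sigma>3 (n - 0) s0) \<le> ennreal (J \<sigma>3 \<sigma>1 \<sigma>2 s0)"
      unfolding ennreal_J
    proof (rule potential_le_expected_payoff[where n = n and W = "\<lambda>t s. ennreal (val_iter E \<sigma>3 (n - t) s)"])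
      fix h :: "'a state list" and t assume h: "length h = Suc t" and t: "t < n"
      from h have "h \<noteq> []" by auto
      then have a2: "set_pmf (\<sigma>2 h) \<subseteq> actions E C2 (last h)"
        using \<sigma>2 unfolding strategies_def by (metis (mono_tags, lifting) append_butlast_last_id mem_Collect_eq)
      have "n - t = Suc (n - Suc t)"
        using t by simp
      with a2 show "ennreal (val_iter E \<sigma>3 (n - t) (last h)) \<le> ennreal (payoff (last h)) +
          (\<integral>\<^sup>+y. ennreal (val_iter E \<sigma>3 (n - Suc t) y) \<partial>next_state \<sigma>3 \<sigma>1 \<sigma>2 h)"
        unfolding payoff_add_nn_integral_next_state ennreal_lookahead[OF val_iter_nonneg, symmetric]
        by (intro nn_integral_pmf_ge ennreal_leI) (auto simp: \<sigma>1_def h intro!: \<alpha>(2))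
    qed (simp add: val_iter_0)
    then show ?thesis
      using J_nonneg[of \<sigma>3 \<sigma>1 \<sigma>2 s0] by simp
  qed
  moreover have "\<sigma>1 \<in> strategies E C1"
    by (simp add: strategies_def \<sigma>1_def \<alpha>(1))
  ultimately show ?thesis by blast
qed

theorem theorem2:
  fixes E :: "'v::finite \<Rightarrow> 'v \<Rightarrow> bool" and \<sigma>3 :: "'v state \<Rightarrow> 'v pmf"
  assumes "simple_graph E" and "connected_graph E" and "robber_strategy E \<sigma>3"
  shows "\<forall>s \<in> S1 \<union> S2. \<exists>v. is_value E \<sigma>3 s v \<and> (\<lambda>i. val_iter E \<sigma>3 i s) \<longlonglongrightarrow> v"
proof
  fix s :: "'v state"
  let ?J = "\<lambda>\<sigma>1 \<sigma>2. ereal (J \<sigma>3 \<sigma>1 \<sigma>2 s)"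
  let ?lower = "SUP \<sigma>1\<in>strategies E C1. INF \<sigma>2\<in>strategies E C2. ?J \<sigma>1 \<sigma>2"
  let ?upper = "INF \<sigma>2\<in>strategies E C2. SUP \<sigma>1\<in>strategies E C1. ?J \<sigma>1 \<sigma>2"
  have "?lower \<le> ?upper"
    by (intro SUP_least INF_greatest) (meson INF_lower SUP_upper order_trans)
  moreover have "?upper \<le> ereal (val_lim E \<sigma>3 s)"
  proof -
    obtain \<sigma>2 where \<sigma>2: "\<sigma>2 \<in> strategies E C2"
      "\<And>\<sigma>1. \<sigma>1 \<in> strategies E C1 \<Longrightarrow> J \<sigma>3 \<sigma>1 \<sigma>2 s \<le> val_lim E \<sigma>3 s"
      using strategy_C2_val_lim by blast
    show ?thesis
      by (rule INF_lower2[OF \<sigma>2(1)]) (auto intro!: SUP_least \<sigma>2(2))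
  qed
  \<comment> \<open>Each strategy from \<open>strategy_C1_val_iter\<close> secures one iterate. It
    suffices that \<open>?lower\<close> bounds all iterates; no single strategy of the first cop has
    to attain the limit.\<close>
  moreover have "ereal (val_lim E \<sigma>3 s) \<le> ?lower"
  proof (rule LIMSEQ_le_const2[OF tendsto_ereal[OF val_iter_tendsto]], intro exI allI impI)
    fix n
    obtain \<sigma>1 where \<sigma>1: "\<sigma>1 \<in> strategies E C1"
      "\<And>\<sigma>2. \<sigma>2 \<in> strategies E C2 \<Longrightarrow> val_iter E \<sigma>3 n s \<le> J \<sigma>3 \<sigma>1 \<sigma>2 s"
      using strategy_C1_val_iter by blast
    show "ereal (val_iter E \<sigma>3 n s) \<le> ?lower"
      by (rule SUP_upper2[OF \<sigma>1(1)]) (auto intro!: INF_greatest \<sigma>1(2))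
  qed
  ultimately have "is_value E \<sigma>3 s (val_lim E \<sigma>3 s)"
    unfolding is_value_def by (meson order_antisym order_trans)
  with val_iter_tendsto show "\<exists>v. is_value E \<sigma>3 s v \<and> (\<lambda>i. val_iter E \<sigma>3 i s) \<longlonglongrightarrow> v"
    by blast
qed

end
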